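(* For every fixed $0<\delta<1$ there exists a constant $C>0$ such that for all sufficiently large $n\in\mathbb{N}$ the following holds. Let $s=(1-\delta)n$ and $d\ge C n^{1+1/(1-\delta)}$. Then every $n\times d$ matrix $M$ with all entries in $\{-1,+1\}$ is not $s$-robust.
   Context: A matrix is called $s$-robust if every $s$ of its columns are linearly independent (over $\mathbb{R}$). *)

theory Defs
  imports Complex_Main "Jordan_Normal_Form.VS_Connect"
begin

(* The columns form a family indexed by column positions, whereas lin_dep speaks about a set
   of vectors; inj_on makes a repeated column count as a linear dependence. *)
definition robust :: "nat \<Rightarrow> real mat \<Rightarrow> bool" where
  "robust s M \<longleftrightarrow>
     (\<forall>J. J \<subseteq> {..<dim_col M} \<and> card J = s \<longrightarrow>
        inj_on (col M) J \<and>
        \<not> LinearCombinations.module.lin_dep class_ring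
            (module_vec TYPE(real) (dim_row M)) (col M ` J))"

end

theory Submission
  imports Defs "HOL-Real_Asymp.Real_Asymp"
begin

text \<open>
  Every set S of k \<approx> s/2 columns can be signed so that the signed sum of its columns has
  squared norm at most kn \<le> n^2. At most O(sqrt n)^n integer points lie in the ball of radius n
  in dimension n, whereas there are at least (d/k)^k sets S, which is more once
  d \<ge> C n^(1 + 1/(1 - \<delta>)). Hence two different sets S and T have the same signed sum, and the
  difference is a nontrivial linear relation between at most 2k \<le> s columns.
\<close>

section \<open>Signed sums of small norm\<close>

text \<open>Parallelogram law: the two left-hand sides add up to twice the common right-hand side,
  so they cannot both exceed it.\<close>

lemma sum_squares_add_or_diff_le:
  fixes x y :: "'i \<Rightarrow> 'a::linordered_idom"
  shows "(\<Sum>i\<in>I. (x i + y i)\<^sup>2) \<le> (\<Sum>i\<in>I. (x i)\<^sup>2) + (\<Sum>i\<in>I. (y i)\<^sup>2) \<or>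
         (\<Sum>i\<in>I. (x i - y i)\<^sup>2) \<le> (\<Sum>i\<in>I. (x i)\<^sup>2) + (\<Sum>i\<in>I. (y i)\<^sup>2)"
proof -
  have "(\<Sum>i\<in>I. (x i + y i)\<^sup>2) + (\<Sum>i\<in>I. (x i - y i)\<^sup>2)
      = ((\<Sum>i\<in>I. (x i)\<^sup>2) + (\<Sum>i\<in>I. (y i)\<^sup>2)) + ((\<Sum>i\<in>I. (x i)\<^sup>2) + (\<Sum>i\<in>I. (y i)\<^sup>2))"
    unfolding sum.distrib[symmetric]
    by (rule sum.cong) (simp_all add: power2_eq_square algebra_simps)
  moreover have "a \<le> c \<or> b \<le> c" if "a + b = c + c" for a b c :: 'a
    using that add_strict_mono[of c a c b] by linarith
  ultimately show ?thesis by blast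
qed

text \<open>The signs are chosen greedily: each new vector is added with the sign for which its
  cross term with the sum so far is not positive.\<close>

lemma exists_signs_sum_squares_le:
  fixes v :: "'j \<Rightarrow> 'i \<Rightarrow> 'a::linordered_idom"
  assumes "finite S"
  shows "\<exists>e. (\<forall>j\<in>S. e j = 1 \<or> e j = -1) \<and>
    (\<Sum>i\<in>I. (\<Sum>j\<in>S. e j * v j i)\<^sup>2) \<le> (\<Sum>j\<in>S. \<Sum>i\<in>I. (v j i)\<^sup>2)"
  using assms
proof (induction S rule: finite_induct)
  case empty
  then show ?case by simp
next
  case (insert a S)
  then obtain e where e: "\<forall>j\<in>S. e j = 1 \<or> e j = -1"
    and le: "(\<Sum>i\<in>I. (\<Sum>j\<in>S. e j * v j i)\<^sup>2) \<le> (\<Sum>j\<in>S. \<Sum>i\<in>I. (v j i)\<^sup>2)"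
    by blast
  have upd: "(\<Sum>j\<in>insert a S. (e(a := t)) j * v j i) = (\<Sum>j\<in>S. e j * v j i) + t * v a i"
    for t i
  proof -
    have "(\<Sum>j\<in>S. (e(a := t)) j * v j i) = (\<Sum>j\<in>S. e j * v j i)"
      using insert.hyps by (intro sum.cong) auto
    then show ?thesis using insert.hyps by simp
  qed
  obtain t where t: "t = 1 \<or> t = -1" and tle:
    "(\<Sum>i\<in>I. ((\<Sum>j\<in>S. e j * v j i) + t * v a i)\<^sup>2)
       \<le> (\<Sum>i\<in>I. (\<Sum>j\<in>S. e j * v j i)\<^sup>2) + (\<Sum>i\<in>I. (v a i)\<^sup>2)"
  proof -
    from sum_squares_add_or_diff_le[where I = I and x = "\<lambda>i. \<Sum>j\<in>S. e j * v j i" and y = "v a"]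
    show thesis
    proof
      assume "(\<Sum>i\<in>I. ((\<Sum>j\<in>S. e j * v j i) + v a i)\<^sup>2)
        \<le> (\<Sum>i\<in>I. (\<Sum>j\<in>S. e j * v j i)\<^sup>2) + (\<Sum>i\<in>I. (v a i)\<^sup>2)"
      then show thesis by (intro that[of 1]) auto
    next
      assume "(\<Sum>i\<in>I. ((\<Sum>j\<in>S. e j * v j i) - v a i)\<^sup>2)
        \<le> (\<Sum>i\<in>I. (\<Sum>j\<in>S. e j * v j i)\<^sup>2) + (\<Sum>i\<in>I. (v a i)\<^sup>2)"
      then show thesis by (intro that[of "-1"]) auto
    qed
  qed
  have "(\<Sum>i\<in>I. (\<Sum>j\<in>insert a S. (e(a := t)) j * v j i)\<^sup>2)
      \<le> (\<Sum>j\<in>insert a S. \<Sum>i\<in>I. (v j i)\<^sup>2)"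
    unfolding upd using tle le insert.hyps by simp
  moreover have "\<forall>j\<in>insert a S. (e(a := t)) j = 1 \<or> (e(a := t)) j = -1"
    using e t by auto
  ultimately show ?case by blast
qed

section \<open>Counting integer points in a ball\<close>

text \<open>The nonnegative and the nonpositive integers each contribute at most a full geometric
  series. Counting 0 twice is harmless, as all terms are nonnegative.\<close>

lemma sum_power_abs_le:
  fixes q :: real
  assumes "0 \<le> q" "q < 1"
  shows "(\<Sum>z\<in>{-int B..int B}. q ^ nat \<bar>z\<bar>) \<le> 2 / (1 - q)"
proof -
  have geom: "(\<Sum>m\<le>B. q ^ m) \<le> 1 / (1 - q)"
    using sum_le_suminf[of "\<lambda>m. q ^ m" "{..B}"] assms suminf_geometric[of q] by simp
  have "(\<Sum>z\<in>{-int B..int B}. q ^ nat \<bar>z\<bar>)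
      \<le> (\<Sum>z\<in>int ` {..B} \<union> (\<lambda>m. - int m) ` {..B}. q ^ nat \<bar>z\<bar>)"
  proof (rule sum_mono2)
    show "{-int B..int B} \<subseteq> int ` {..B} \<union> (\<lambda>m. - int m) ` {..B}"
    proof
      fix z assume "z \<in> {-int B..int B}"
      then have "z = int (nat z) \<and> nat z \<le> B \<or> z = - int (nat (-z)) \<and> nat (-z) \<le> B"
        by auto
      then show "z \<in> int ` {..B} \<union> (\<lambda>m. - int m) ` {..B}" by blast
    qed
  qed (use assms in auto)
  also have "\<dots> \<le> (\<Sum>z\<in>int ` {..B}. q ^ nat \<bar>z\<bar>) + (\<Sum>z\<in>(\<lambda>m. - int m) ` {..B}. q ^ nat \<bar>z\<bar>)"
    by (subst sum.union_inter[symmetric]) (use assms in \<open>auto intro: sum_nonneg\<close>)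
  also have "\<dots> = 2 * (\<Sum>m\<le>B. q ^ m)"
    by (subst (1 2) sum.reindex) (auto simp: inj_on_def)
  also have "\<dots> \<le> 2 / (1 - q)" using geom by simp
  finally show ?thesis .
qed

text \<open>Exponential weights: \<open>f\<close> gets the weight \<Prod>
  \<open>q ^ nat \<bar>f i\<bar>\<close>. A point of the ball weighs at least
  \<open>exp (- n)\<close>, while the weight of the whole box is a product of \<open>n\<close>
  one-dimensional sums of order \<open>sqrt n\<close>. Dividing the two bounds the count.\<close>

lemma card_lattice_points_ball_le:
  fixes n :: nat
  assumes "n \<ge> 1"
  shows "real (card {f \<in> {..<n} \<rightarrow>\<^sub>E {-int n..int n}. (\<Sum>i<n. (f i)\<^sup>2) \<le> int (n * n)})
    \<le> (4 * exp 1 * sqrt n) ^ n"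
proof -
  \<comment> \<open>This scale balances both estimates: weights in the ball stay above
    \<open>exp (- n)\<close>, and \<open>1 - q\<close> is of order
    \<open>1 / sqrt n\<close>.\<close>
  define t where "t = 1 / sqrt n"
  define q where "q = exp (- t)"
  let ?P = "{..<n} \<rightarrow>\<^sub>E {-int n..int n}"
  let ?X = "{f \<in> ?P. (\<Sum>i<n. (f i)\<^sup>2) \<le> int (n * n)}"
  have t0: "t > 0" using assms by (simp add: t_def)
  have q: "0 \<le> q" "q < 1" using t0 by (auto simp: q_def)
  have finP: "finite ?P" by (intro finite_PiE) auto
  have w: "exp (- real n) \<le> (\<Prod>i<n. q ^ nat \<bar>f i\<bar>)" if "f \<in> ?X" for f
  proof -
    \<comment> \<open>AM-GM for \<open>1\<close> and \<open>(t * f i)^2\<close>. Summed over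
      \<open>i\<close>, with squared norm at most \<open>n * n\<close>, it gives
      \<open>(n + n) / 2 = n\<close>.\<close>
    have "t * \<bar>real_of_int (f i)\<bar> \<le> (1 + (real_of_int (f i))\<^sup>2 / n) / 2" for i
    proof -
      have "0 \<le> (1 - t * \<bar>real_of_int (f i)\<bar>)\<^sup>2" by simp
      also have "\<dots> = 1 - 2 * (t * \<bar>real_of_int (f i)\<bar>) + t\<^sup>2 * (real_of_int (f i))\<^sup>2"
        by (simp add: power2_diff power_mult_distrib)
      also have "t\<^sup>2 = 1 / n" by (simp add: t_def power_divide)
      finally show ?thesis by simp
    qed
    then have "(\<Sum>i<n. t * \<bar>real_of_int (f i)\<bar>) \<le> (\<Sum>i<n. (1 + (real_of_int (f i))\<^sup>2 / n) / 2)"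
      by (intro sum_mono) auto
    also have "\<dots> = (n + (\<Sum>i<n. (real_of_int (f i))\<^sup>2) / n) / 2"
      by (simp add: sum_divide_distrib[symmetric] sum.distrib)
    also have "(\<Sum>i<n. (real_of_int (f i))\<^sup>2) = real_of_int (\<Sum>i<n. (f i)\<^sup>2)" by simp
    also have "(n + real_of_int (\<Sum>i<n. (f i)\<^sup>2) / n) / 2 \<le> (n + real_of_int (int (n * n)) / n) / 2"
      using that by (intro divide_right_mono add_left_mono) (auto simp only: of_int_le_iff)
    also have "\<dots> = n" using assms by simp
    finally have le: "(\<Sum>i<n. t * \<bar>real_of_int (f i)\<bar>) \<le> n" .
    have "(\<Prod>i<n. q ^ nat \<bar>f i\<bar>) = (\<Prod>i<n. exp (- (t * \<bar>real_of_int (f i)\<bar>)))"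
      unfolding q_def exp_of_nat_mult[symmetric] by (intro prod.cong) (auto simp: mult.commute)
    also have "\<dots> = exp (- (\<Sum>i<n. t * \<bar>real_of_int (f i)\<bar>))"
      by (simp add: exp_sum sum_negf[symmetric])
    finally show ?thesis using le by simp
  qed
  have "real (card ?X) * exp (- real n) = (\<Sum>f\<in>?X. exp (- real n))" by simp
  also have "\<dots> \<le> (\<Sum>f\<in>?X. \<Prod>i<n. q ^ nat \<bar>f i\<bar>)" by (rule sum_mono) (rule w)
  \<comment> \<open>Enlarging the ball to the box makes the sum factor over the coordinates.\<close>
  also have "\<dots> \<le> (\<Sum>f\<in>?P. \<Prod>i<n. q ^ nat \<bar>f i\<bar>)"
  proof (rule sum_mono2[OF finP])
    show "0 \<le> (\<Prod>i<n. q ^ nat \<bar>f i\<bar>)" for f :: "nat \<Rightarrow> int"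
      using q by (intro prod_nonneg) simp
  qed blast
  also have "\<dots> = (\<Prod>i<n. \<Sum>z\<in>{-int n..int n}. q ^ nat \<bar>z\<bar>)"
    by (rule prod_sum_PiE[symmetric]) auto
  also have "\<dots> = (\<Sum>z\<in>{-int n..int n}. q ^ nat \<bar>z\<bar>) ^ n" by simp
  also have "\<dots> \<le> (4 * sqrt n) ^ n"
  proof (rule power_mono)
    have "1 + t \<le> exp t" by simp
    then have "q \<le> 1 / (1 + t)" using t0 by (simp add: q_def exp_minus field_simps)
    then have "1 - q \<ge> t / (1 + t)" using t0 by (simp add: field_simps)
    then have "2 / (1 - q) \<le> 2 / (t / (1 + t))"
      using t0 q by (intro divide_left_mono) auto
    also have "\<dots> = 2 * (1 + sqrt n)" using assms by (simp add: t_def field_simps)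
    also have "\<dots> \<le> 4 * sqrt n" using assms by simp
    finally show "(\<Sum>z\<in>{-int n..int n}. q ^ nat \<bar>z\<bar>) \<le> 4 * sqrt n"
      using sum_power_abs_le[OF q, of n] by linarith
  qed (use q in \<open>auto intro: sum_nonneg\<close>)
  finally have "real (card ?X) * exp (- real n) * exp n \<le> (4 * sqrt n) ^ n * exp n"
    by (intro mult_right_mono) auto
  also have "real (card ?X) * exp (- real n) * exp n = card ?X"
    by (simp add: exp_minus field_simps)
  also have "(4 * sqrt n) ^ n * exp n = (4 * exp 1 * sqrt n) ^ n"
    using exp_of_nat_mult[of n "1::real"] by (simp add: power_mult_distrib)
  finally show ?thesis .
qed

section \<open>Pigeonhole on sets of columns\<close>

text \<open>By \<open>many\<close> there are more \<open>k\<close>-sets of columns than integer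
  points in the ball of radius \<open>n\<close>, so two of them have equal signed sums. The relation
  \<open>c\<close> is the difference of their sign vectors, extended by 0.\<close>

lemma exists_sparse_integer_relation:
  fixes A :: "nat \<Rightarrow> nat \<Rightarrow> int"
  assumes "n \<ge> 1" "k \<le> n"
    and A: "\<And>i j. i < n \<Longrightarrow> j < d \<Longrightarrow> \<bar>A i j\<bar> \<le> 1"
    and many: "(4 * exp 1 * sqrt n) ^ n < real (d choose k)"
  obtains U and c :: "nat \<Rightarrow> int" where "U \<subseteq> {..<d}" "card U \<le> 2 * k"
    "\<exists>j\<in>U. c j \<noteq> 0" "\<forall>j. j \<notin> U \<longrightarrow> c j = 0" "\<forall>i<n. (\<Sum>j\<in>U. c j * A i j) = 0"
proof -
  define F where "F = {S. S \<subseteq> {..<d} \<and> card S = k}"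
  let ?X = "{f \<in> {..<n} \<rightarrow>\<^sub>E {-int n..int n}. (\<Sum>i<n. (f i)\<^sup>2) \<le> int (n * n)}"
  have finX: "finite ?X" by (intro finite_Collect_conjI disjI1) (auto intro!: finite_PiE)
  have cardF: "card F = d choose k" using n_subsets[of "{..<d}" k] by (simp add: F_def)
  have finS: "finite S" if "S \<in> F" for S using that finite_subset by (auto simp: F_def)
  have "\<forall>S\<in>F. \<exists>e::nat\<Rightarrow>int. (\<forall>j\<in>S. e j = 1 \<or> e j = -1) \<and>
    (\<Sum>i<n. (\<Sum>j\<in>S. e j * A i j)\<^sup>2) \<le> (\<Sum>j\<in>S. \<Sum>i<n. (A i j)\<^sup>2)"
    by (intro ballI exists_signs_sum_squares_le[where v = "\<lambda>j i. A i j"] finS)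
  then obtain e :: "nat set \<Rightarrow> nat \<Rightarrow> int" where
    "\<forall>S\<in>F. (\<forall>j\<in>S. e S j = 1 \<or> e S j = -1) \<and>
      (\<Sum>i<n. (\<Sum>j\<in>S. e S j * A i j)\<^sup>2) \<le> (\<Sum>j\<in>S. \<Sum>i<n. (A i j)\<^sup>2)"
    by (rule bchoice[THEN exE])
  then have e: "\<And>S j. S \<in> F \<Longrightarrow> j \<in> S \<Longrightarrow> e S j = 1 \<or> e S j = -1"
    and ele: "\<And>S. S \<in> F \<Longrightarrow> (\<Sum>i<n. (\<Sum>j\<in>S. e S j * A i j)\<^sup>2) \<le> (\<Sum>j\<in>S. \<Sum>i<n. (A i j)\<^sup>2)"
    by blast+
  \<comment> \<open>The restriction to \<open>{..<n}\<close> puts \<open>g S\<close> into the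
    extensional function space in which the points were counted.\<close>
  define g where "g S = (\<lambda>i\<in>{..<n}. \<Sum>j\<in>S. e S j * A i j)" for S
  have "g S \<in> ?X" if S: "S \<in> F" for S
  proof -
    have "(\<Sum>i<n. (g S i)\<^sup>2) = (\<Sum>i<n. (\<Sum>j\<in>S. e S j * A i j)\<^sup>2)" by (simp add: g_def)
    also have "\<dots> \<le> (\<Sum>j\<in>S. \<Sum>i<n. (A i j)\<^sup>2)" by (rule ele[OF S])
    also have "\<dots> \<le> (\<Sum>j\<in>S. \<Sum>i<n. 1)"
    proof (intro sum_mono)
      fix i j assume "j \<in> S" "i \<in> {..<n}"
      then have "\<bar>A i j\<bar> \<le> 1" using A S by (auto simp: F_def)
      then show "(A i j)\<^sup>2 \<le> 1" by (simp add: abs_square_le_1)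
    qed
    also have "\<dots> = int (k * n)" using S by (simp add: F_def)
    also have "\<dots> \<le> int (n * n)" using \<open>k \<le> n\<close> by (simp only: of_nat_le_iff mult_le_mono1)
    finally have le: "(\<Sum>i<n. (g S i)\<^sup>2) \<le> int (n * n)" .
    have "g S i \<in> {-int n..int n}" if "i < n" for i
    proof -
      \<comment> \<open>A single square is at most the squared norm, so the ball lies in the
        box.\<close>
      have "(g S i)\<^sup>2 \<le> (\<Sum>i<n. (g S i)\<^sup>2)" using that by (intro member_le_sum) auto
      with le have "(g S i)\<^sup>2 \<le> (int n)\<^sup>2" by (simp add: power2_eq_square)
      then have "\<bar>g S i\<bar> \<le> int n" using power2_le_iff_abs_le[of "int n" "g S i"] by simp
      then show ?thesis by auto
    qed
    then have "g S \<in> {..<n} \<rightarrow>\<^sub>E {-int n..int n}" by (auto simp: g_def PiE_def extensional_def)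
    then show ?thesis using le by simp
  qed
  then have "g ` F \<subseteq> ?X" by blast
  moreover have "card ?X < card F"
    using card_lattice_points_ball_le[OF \<open>n \<ge> 1\<close>] many cardF by linarith
  ultimately have "\<not> inj_on g F" using card_inj_on_le[OF _ _ finX] by fastforce
  then obtain S T where ST: "S \<in> F" "T \<in> F" "S \<noteq> T" "g S = g T" by (auto simp: inj_on_def)
  define x where "x S j = (if j \<in> S then e S j else 0)" for S j
  have sum_x: "(\<Sum>j\<in>S \<union> T. x R j * A i j) = g R i" if "i < n" "R = S \<or> R = T" for R i
  proof -
    have "(\<Sum>j\<in>S \<union> T. x R j * A i j) = (\<Sum>j\<in>R. e R j * A i j)"
      by (rule sum.mono_neutral_cong_right) (use that ST finS in \<open>auto simp: x_def\<close>)
    then show ?thesis using that by (simp add: g_def)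
  qed
  show thesis
  proof
    show "S \<union> T \<subseteq> {..<d}" using ST by (auto simp: F_def)
    show "card (S \<union> T) \<le> 2 * k" using card_Un_le[of S T] ST by (simp add: F_def)
    \<comment> \<open>On \<open>S \<inter> T\<close> the signs may cancel. At an index of the
      symmetric difference exactly one of the two values is nonzero.\<close>
    obtain j where "j \<in> S \<and> j \<notin> T \<or> j \<in> T \<and> j \<notin> S" using ST by blast
    then show "\<exists>j\<in>S \<union> T. x S j - x T j \<noteq> 0"
      using e ST by (intro bexI[of _ j]) (force simp: x_def)+
    show "\<forall>j. j \<notin> S \<union> T \<longrightarrow> x S j - x T j = 0" by (simp add: x_def)
    show "\<forall>i<n. (\<Sum>j\<in>S \<union> T. (x S j - x T j) * A i j) = 0"
      using sum_x ST by (simp add: left_diff_distrib sum_subtractf)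
  qed
qed

section \<open>From a sparse relation to failure of robustness\<close>

text \<open>Robustness concerns exactly \<open>s\<close> columns, so \<open>U\<close> is padded to a
  set \<open>J\<close> of that size, with zero coefficients on the new columns.\<close>

lemma not_robust_if_relation:
  fixes M :: "real mat" and c :: "nat \<Rightarrow> real"
  assumes U: "U \<subseteq> {..<dim_col M}" "card U \<le> s" and s: "s \<le> dim_col M"
    and nz: "\<exists>j\<in>U. c j \<noteq> 0" and supp: "\<And>j. j \<notin> U \<Longrightarrow> c j = 0"
    and rel: "\<And>i. i < dim_row M \<Longrightarrow> (\<Sum>j\<in>U. c j * M $$ (i, j)) = 0"
  shows "\<not> robust s M"
proof
  assume rob: "robust s M"
  define n where "n = dim_row M"
  interpret vec_space "TYPE(real)" n .
  obtain J where J: "U \<subseteq> J" "J \<subseteq> {..<dim_col M}" "card J = s"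
    using exists_subset_between[of U s "{..<dim_col M}"] U s by auto
  have finJ: "finite J" using J finite_subset by blast
  have inj: "inj_on (col M) J" and indep: "\<not> lin_dep (col M ` J)"
    using rob J unfolding robust_def n_def by auto
  \<comment> \<open>\<open>lincomb\<close> takes coefficients indexed by vectors. Since
    \<open>col M\<close> is injective on \<open>J\<close>, those indexed by positions can be
    transported.\<close>
  define a where "a v = c (the_inv_into J (col M) v)" for v
  have a: "a (col M j) = c j" if "j \<in> J" for j
    using the_inv_into_f_f[OF inj that] by (simp add: a_def)
  have car: "col M ` J \<subseteq> carrier_vec n" by (auto simp: n_def)
  have "lincomb a (col M ` J) = 0\<^sub>v n"
  proof (rule eq_vecI)
    fix i assume "i < dim_vec (0\<^sub>v n :: real vec)"
    then have i: "i < n" by simp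
    have "lincomb a (col M ` J) $ i = (\<Sum>v\<in>col M ` J. a v * v $ i)"
      using lincomb_index[OF i car] by simp
    also have "\<dots> = (\<Sum>j\<in>J. c j * M $$ (i, j))"
      using J i by (subst sum.reindex[OF inj]) (auto intro!: sum.cong simp: a n_def)
    also have "\<dots> = (\<Sum>j\<in>U. c j * M $$ (i, j))"
      using J finJ supp by (intro sum.mono_neutral_right) auto
    finally show "lincomb a (col M ` J) $ i = 0\<^sub>v n $ i" using rel i by (simp add: n_def)
  qed (use lincomb_dim[OF _ car] finJ in auto)
  moreover obtain j where "j \<in> U" "c j \<noteq> 0" using nz by blast
  moreover have "col M j \<in> col M ` J" "a (col M j) = c j" using \<open>j \<in> U\<close> J a by auto
  ultimately have "lin_dep (col M ` J)"
    unfolding lin_dep_def using finJ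
    by (intro exI[of _ "col M ` J"] exI[of _ a] exI[of _ "col M j"]) auto
  with indep show False by simp
qed

text \<open>The pigeonhole argument needs integer vectors, so it is applied to an integer copy
  \<open>A\<close> of \<open>M\<close>, and the relation is cast back to the reals.\<close>

lemma sign_matrix_not_robust:
  fixes M :: "real mat"
  assumes M: "M \<in> carrier_mat n d" "elements_mat M \<subseteq> {-1, 1}"
    and "n \<ge> 1" "k \<le> n" "2 * k \<le> s" "s \<le> d"
    and many: "(4 * exp 1 * sqrt n) ^ n < real (d choose k)"
  shows "\<not> robust s M"
proof -
  define A :: "nat \<Rightarrow> nat \<Rightarrow> int" where "A i j = (if M $$ (i, j) = 1 then 1 else -1)" for i j
  have ent: "M $$ (i, j) = -1 \<or> M $$ (i, j) = 1" if "i < n" "j < d" for i j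
  proof -
    have "M $$ (i, j) \<in> elements_mat M" 
      using that M(1) by (auto simp: elements_mat_def intro!: bexI[of _ i])
    then show ?thesis using M(2) by auto
  qed
  have A: "\<bar>A i j\<bar> \<le> 1" "real_of_int (A i j) = M $$ (i, j)" if "i < n" "j < d" for i j
    using ent[OF that] by (auto simp: A_def)
  obtain U and c :: "nat \<Rightarrow> int" where c: "U \<subseteq> {..<d}" "card U \<le> 2 * k"
    "\<exists>j\<in>U. c j \<noteq> 0" "\<forall>j. j \<notin> U \<longrightarrow> c j = 0" "\<forall>i<n. (\<Sum>j\<in>U. c j * A i j) = 0"
    by (rule exists_sparse_integer_relation[OF \<open>n \<ge> 1\<close> \<open>k \<le> n\<close> A(1) many])
  have rel: "(\<Sum>j\<in>U. real_of_int (c j) * M $$ (i, j)) = 0" if "i < n" for i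
  proof -
    have "(\<Sum>j\<in>U. real_of_int (c j) * M $$ (i, j)) = real_of_int (\<Sum>j\<in>U. c j * A i j)"
      unfolding of_int_sum of_int_mult using c(1) A(2)[OF that] by (intro sum.cong) auto
    then show ?thesis using c(5) that by simp
  qed
  show ?thesis
    by (rule not_robust_if_relation[of U M s "\<lambda>j. real_of_int (c j)"])
       (use M c rel assms in auto)
qed

section \<open>Growth estimates and choice of constants\<close>

text \<open>With \<open>D\<close> the left side of \<open>large\<close>, the exponents are such that
  \<open>D powr (\<alpha> * n / 2)\<close> is \<open>2 ^ n\<close> times the number to be beaten.
  Rounding in \<open>k\<close> loses at most one factor \<open>D\<close>, which \<open>2 ^ n\<close>
  outweighs; this is why \<open>2 * B\<close> stands in place of \<open>B\<close>.\<close>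

lemma lattice_points_less_choose:
  fixes \<alpha> B :: real
  assumes "0 < \<alpha>" "1 \<le> B" "1 \<le> n" "1 \<le> k" "k \<le> n" "\<alpha> * n / 2 - 1 \<le> k" "k \<le> d"
    and d: "(2 * B) powr (2 / \<alpha>) * real n powr (1 + 1 / \<alpha>) \<le> d"
    and large: "(2 * B) powr (2 / \<alpha>) * real n powr (1 / \<alpha>) < 2 ^ n"
  shows "(B * sqrt n) ^ n < real (d choose k)"
proof -
  define D where "D = (2 * B) powr (2 / \<alpha>) * real n powr (1 / \<alpha>)"
  have n0: "real n > 0" using assms by simp
  have "1 \<le> (2 * B) powr (2 / \<alpha>)" "1 \<le> real n powr (1 / \<alpha>)"
    using assms by (auto intro!: ge_one_powr_ge_zero)
  then have D1: "1 \<le> D" unfolding D_def using mult_mono[of 1 _ 1] by fastforce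
  have "D powr (\<alpha> * n / 2) = (2 * B) powr n * real n powr (n / 2)"
    unfolding D_def using assms by (subst powr_mult) (auto simp: powr_powr)
  also have "\<dots> = 2 ^ n * (B * sqrt n) ^ n"
    using assms by (simp add: powr_realpow power_mult_distrib powr_half_sqrt[symmetric] powr_powr
        flip: powr_realpow[of "real n powr (1/2)"])
  finally have D2: "D powr (\<alpha> * n / 2) = 2 ^ n * (B * sqrt n) ^ n" .
  have pos: "0 < (B * sqrt n) ^ n" using assms by simp
  have "D * (B * sqrt n) ^ n < D powr (\<alpha> * n / 2)"
    unfolding D2 using large pos by (simp add: D_def)
  then have "(B * sqrt n) ^ n < D powr (\<alpha> * n / 2) / D" using D1 by (simp add: field_simps)
  also have "\<dots> = D powr (\<alpha> * n / 2 - 1)" using D1 by (simp add: powr_diff)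
  also have "\<dots> \<le> D powr k" using D1 assms by (intro powr_mono) auto
  also have "\<dots> = D ^ k" using D1 by (simp add: powr_realpow)
  also have "\<dots> \<le> (real d / real k) ^ k"
  proof (rule power_mono)
    \<comment> \<open>The extra factor \<open>n\<close> in the bound on \<open>d\<close> absorbs the
      denominator \<open>k \<le> n\<close>.\<close>
    have "D * real k \<le> D * real n" using D1 assms by simp
    also have "\<dots> \<le> d" using d n0 by (simp add: D_def powr_add mult_ac)
    finally show "D \<le> real d / real k" using assms by (simp add: field_simps)
  qed (use D1 in simp)
  also have "\<dots> \<le> real (d choose k)" using binomial_ge_n_over_k_pow_k[OF \<open>k \<le> d\<close>] by simp
  finally show ?thesis .
qed

text \<open>As (1 - \<delta>) n need not be an integer, it is rounded down. This is the stronger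
  choice: a dependence among fewer columns persists in every larger set of columns.\<close>

theorem theorem1p1:
  fixes \<delta> :: real
  assumes "0 < \<delta>" and "\<delta> < 1"
  shows "\<exists>C::real. C > 0 \<and>
    (\<forall>\<^sub>F n in sequentially. \<forall>d::nat.
       real d \<ge> C * real n powr (1 + 1 / (1 - \<delta>)) \<longrightarrow>
       (\<forall>M::real mat. M \<in> carrier_mat n d \<and> elements_mat M \<subseteq> {-1, 1} \<longrightarrow>
          \<not> robust (nat \<lfloor>(1 - \<delta>) * real n\<rfloor>) M))"
proof -
  define \<alpha> where "\<alpha> = 1 - \<delta>"
  have \<alpha>: "0 < \<alpha>" "\<alpha> < 1" using assms by (auto simp: \<alpha>_def)
  \<comment> \<open>The base in the bound on the number of integer points.\<close>
  define B :: real where "B = 4 * exp 1"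
  have B: "1 \<le> B" using exp_ge_add_one_self[of "1::real"] unfolding B_def by linarith
  define C where "C = (2 * B) powr (2 / \<alpha>)"
  have C: "1 \<le> C" unfolding C_def using B \<alpha> by (intro ge_one_powr_ge_zero) auto
  have ev1: "\<forall>\<^sub>F n in sequentially. C * real n powr (1 / \<alpha>) < 2 ^ n"
    using C \<alpha> by real_asymp
  \<comment> \<open>Makes \<open>s\<close> large enough for \<open>k = s div 2\<close> to be
    positive.\<close>
  have ev2: "\<forall>\<^sub>F n in sequentially. 4 \<le> \<alpha> * real n"
    using \<alpha> by real_asymp
  have "\<forall>\<^sub>F n in sequentially. \<forall>d::nat. real d \<ge> C * real n powr (1 + 1 / \<alpha>) \<longrightarrow>
       (\<forall>M::real mat. M \<in> carrier_mat n d \<and> elements_mat M \<subseteq> {-1, 1} \<longrightarrow>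
          \<not> robust (nat \<lfloor>\<alpha> * real n\<rfloor>) M)"
    using ev1 ev2
  proof eventually_elim
    case (elim n)
    define s where "s = nat \<lfloor>\<alpha> * real n\<rfloor>"
    define k where "k = s div 2"
    have n1: "1 \<le> n" using elim(2) by (cases n) auto
    have s: "real s \<le> \<alpha> * n" "\<alpha> * n < real s + 1" using elim(2) unfolding s_def by linarith+
    have k: "2 * k \<le> s" "s \<le> 2 * k + 1" unfolding k_def by auto
    have "\<alpha> * real n \<le> 1 * real n" using \<alpha> by (intro mult_right_mono) auto
    then have "s \<le> n" using s by linarith
    have k1: "1 \<le> k" using s elim(2) unfolding k_def by linarith
    show ?case
    proof (intro allI impI, elim conjE)
      fix d :: nat and M :: "real mat"
      assume d: "real d \<ge> C * real n powr (1 + 1 / \<alpha>)"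
        and M: "M \<in> carrier_mat n d" "elements_mat M \<subseteq> {-1, 1}"
      \<comment> \<open>There are enough columns to choose from, because \<open>C\<close> and the
        exponent are both at least 1.\<close>
      have "real n = 1 * real n powr 1" using n1 by simp
      also have "\<dots> \<le> C * real n powr (1 + 1 / \<alpha>)"
        using C n1 \<alpha> by (intro mult_mono powr_mono) auto
      finally have "n \<le> d" using d by simp
      have "(B * sqrt n) ^ n < real (d choose k)"
      proof (rule lattice_points_less_choose[of \<alpha>])
        \<comment> \<open>Both roundings together cost at most 1, since \<alpha> n < s + 1 \<le> 2 k
          + 2.\<close>
        show "\<alpha> * n / 2 - 1 \<le> k" using s k by linarith
      qed (use \<alpha> B n1 k1 k \<open>s \<le> n\<close> \<open>n \<le> d\<close> d elim(1) in \<open>auto simp: C_def\<close>)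
      then have "\<not> robust s M"
        using M n1 k \<open>s \<le> n\<close> \<open>n \<le> d\<close> by (intro sign_matrix_not_robust[of M n d k]) (auto simp: B_def)
      then show "\<not> robust (nat \<lfloor>\<alpha> * real n\<rfloor>) M" by (simp add: s_def)
    qed
  qed
  then show ?thesis using C unfolding \<alpha>_def by (intro exI[of _ C]) auto
qed

end
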